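(* Let $n\ge 1$, $\alpha\in(0,1]$, $R>0$, $C>0$, $0<\delta<1$. For $\boldsymbol{z}\in\mathbb{B}_n$ let $G_{\boldsymbol{z}}=\{\boldsymbol{z}'\in\mathbb{R}^n : \|\boldsymbol{z}'-\boldsymbol{z}\|\le R\}$. Put $$\xi=\frac{1}{2\alpha}+R\left(1+\frac1\alpha\right),$$ and assume $\xi<1$. Let $r$ satisfy $1>r>\xi$. Let $Y\subset\mathbb{B}_n$ be a finite set with $$|Y|<\delta\,\frac1C\left(\frac r\xi\right)^n .$$ Let $\boldsymbol{x}$ be a random point of $\mathbb{B}_n$ whose distribution has a probability density $\rho$ satisfying $$\rho(\boldsymbol{x})<\frac{C}{r^nV_n(\mathbb{B}_n)} .$$ Then with probability $p>1-\delta$ the following holds for every $\boldsymbol{y}\in Y$: $$\alpha(\boldsymbol{x},\boldsymbol{x}')\ge(\boldsymbol{x},\boldsymbol{y}')\quad\text{for all }\boldsymbol{x}'\in G_{\boldsymbol{x}},\ \boldsymbol{y}'\in G_{\boldsymbol{y}} .$$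
   Context: $(\cdot,\cdot)$ and $\|\cdot\|$ are the standard inner product and Euclidean norm on $\mathbb{R}^n$; $\mathbb{B}_n$ is the unit ball of $\mathbb{R}^n$ centred at the origin and $V_n(\mathbb{B}_n)$ is its volume. The balls $G_{\boldsymbol{z}}$ are called spherical granules of radius $R$ with centre $\boldsymbol{z}$. *)

theory Defs
  imports "HOL-Probability.Probability"
begin

definition spherical_granule :: "real \<Rightarrow> real ^ 'n \<Rightarrow> (real ^ 'n) set" where
  "spherical_granule R z = {z'. norm (z' - z) \<le> R}"

text \<open>
  The unit ball is closed. With the open ball instead, a set \<open>Y\<close> inside it is also inside the
  closed one, and a density on it, extended by 0 to the sphere, satisfies the same upper bound.
\<close>

abbreviation unit_ball :: "(real ^ 'n) set" where
  "unit_ball \<equiv> cball 0 1"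

end

theory Submission
  imports Defs
begin

text \<open>
  By the Cauchy-Schwarz inequality, a point \<open>x\<close> of the unit ball can violate the separation
  inequality for \<open>y\<close> only if it lies in the ball of radius \<open>\<xi>\<close> about \<open>y / (2 \<alpha>)\<close>. The bound on the
  density gives this ball probability at most \<open>C (\<xi> / r)\<^sup>n\<close>, and a union bound over
  \<open>Y\<close> concludes.
\<close>

text \<open>Here \<open>u\<close> and \<open>v\<close> are displacements inside the granules about
  \<open>x\<close> and \<open>y\<close>. Each inner product of \<open>x\<close> with a displacement
  is at most \<open>R\<close> in absolute value, which leaves a quadratic inequality in
  \<open>x\<close> alone; completing the square turns it into membership in a ball.\<close>

lemma violation_in_ball:
  fixes x y u v :: "'a::euclidean_space"
  assumes \<alpha>: "0 < \<alpha>" "\<alpha> \<le> 1" and R: "R > 0"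
    and norms: "norm x \<le> 1" "norm y \<le> 1" "norm u \<le> R" "norm v \<le> R"
    and violation: "\<alpha> * (x \<bullet> (x + u)) < x \<bullet> (y + v)"
  shows "x \<in> ball ((1 / (2 * \<alpha>)) *\<^sub>R y) (1 / (2 * \<alpha>) + R * (1 + 1 / \<alpha>))"
proof -
  define s where "s = R * (1 + 1 / \<alpha>)"
  have s: "s > 0" using \<alpha> R by (simp add: s_def add_pos_pos)
  have inner_le: "\<bar>x \<bullet> w\<bar> \<le> R" if "norm w \<le> R" for w
  proof -
    have "\<bar>x \<bullet> w\<bar> \<le> norm x * norm w" by (rule Cauchy_Schwarz_ineq2)
    also have "\<dots> \<le> 1 * R" using norms(1) that by (intro mult_mono) auto
    finally show ?thesis by simp
  qed
  have "- R \<le> x \<bullet> u" "x \<bullet> v \<le> R"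
    using inner_le[OF norms(3)] inner_le[OF norms(4)] by auto
  moreover from this(1) have "- (\<alpha> * R) \<le> \<alpha> * (x \<bullet> u)"
    using \<alpha> mult_left_mono[of "- R" "x \<bullet> u" \<alpha>] by simp
  ultimately have "\<alpha> * (x \<bullet> x) - x \<bullet> y < \<alpha> * R + R"
    using violation by (simp add: inner_add_right distrib_left)
  also have "\<alpha> * R + R = \<alpha> * s" using \<alpha> by (simp add: s_def field_simps)
  finally have "\<alpha> * (x \<bullet> x - x \<bullet> y / \<alpha>) < \<alpha> * s"
    using \<alpha> by (simp add: right_diff_distrib)
  then have 1: "x \<bullet> x - x \<bullet> y / \<alpha> < s" using \<alpha> by simp
  \<comment> \<open>Completing the square in \<open>x\<close> produces the centre
    \<open>y / (2 * \<alpha>)\<close>; the extra constant is controlled by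
    \<open>norm y \<le> 1\<close>.\<close>
  have "(norm (x - (1 / (2 * \<alpha>)) *\<^sub>R y))\<^sup>2 = x \<bullet> x - x \<bullet> y / \<alpha> + (norm y)\<^sup>2 * (1 / (2 * \<alpha>))\<^sup>2"
    unfolding power2_norm_eq_inner
    by (simp add: inner_diff inner_commute power2_eq_square)
  also have "\<dots> < s + (1 / (2 * \<alpha>))\<^sup>2"
    using 1 norms(2) mult_right_mono[of "(norm y)\<^sup>2" 1 "(1 / (2 * \<alpha>))\<^sup>2"]
    by (simp add: power_le_one)
  also have "\<dots> \<le> (1 / (2 * \<alpha>) + s)\<^sup>2"
  proof -
    \<comment> \<open>The cross term of the expanded square is \<open>s / \<alpha>\<close>, so
      \<alpha> \<le> 1 makes it absorb \<open>s\<close>.\<close>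
    have "s \<le> s / \<alpha>" using s \<alpha> by (simp add: field_simps)
    then show ?thesis by (simp add: power2_sum add_increasing)
  qed
  finally have "norm (x - (1 / (2 * \<alpha>)) *\<^sub>R y) < 1 / (2 * \<alpha>) + s"
    by (rule power2_less_imp_less) (use s \<alpha> in simp)
  then show ?thesis by (simp add: s_def dist_norm norm_minus_commute)
qed

text \<open>Translating the granule to the origin makes the range of the quantifier independent of
  its centre. This serves both the closedness argument and the extraction of displacements from a
  violation.\<close>

lemma ball_spherical_granule_iff:
  "(\<forall>z'\<in>spherical_granule R z. P z') \<longleftrightarrow> (\<forall>u\<in>cball 0 R. P (z + u))"
proof
  assume *: "\<forall>u\<in>cball 0 R. P (z + u)"
  show "\<forall>z'\<in>spherical_granule R z. P z'"
    using bspec[OF *, of "z' - z" for z'] by (simp add: spherical_granule_def)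
qed (simp add: spherical_granule_def)

text \<open>For fixed displacements both sides are continuous in \<open>x\<close>, so the set is an
  intersection of closed sets. Closedness is wanted for the measurability of the good event.\<close>

lemma closed_granules_separated:
  "closed {x. \<forall>x'\<in>spherical_granule R x. \<forall>y'\<in>spherical_granule R y. \<alpha> * (x \<bullet> x') \<ge> x \<bullet> y'}"
proof -
  have "closed {x. \<forall>u\<in>cball 0 R. \<forall>v\<in>cball 0 R. \<alpha> * (x \<bullet> (x + u)) \<ge> x \<bullet> (y + v)}"
    unfolding Ball_def
    by (intro closed_Collect_all closed_Collect_imp open_Collect_const closed_Collect_le
        continuous_intros)
  then show ?thesis by (simp add: ball_spherical_granule_iff)
qed

lemma (in prob_space) prob_le_of_bounded_density:
  assumes X: "distributed M (restrict_space lborel U) X f"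
    and U: "U \<in> sets borel" and A: "A \<in> sets borel" "emeasure lborel A < \<infinity>"
    and K: "\<And>x. x \<in> U \<Longrightarrow> f x \<le> ennreal K" "0 \<le> K"
  shows "prob {\<omega> \<in> space M. X \<omega> \<in> A} \<le> K * measure lborel A"
proof -
  let ?N = "restrict_space lborel U"
  have XU: "X \<omega> \<in> U" if "\<omega> \<in> space M" for \<omega>
    using measurable_space[OF distributed_measurable[OF X] that] by (simp add: space_restrict_space)
  have AU: "A \<inter> U \<in> sets ?N"
    using U A by (auto simp: sets_restrict_space)
  \<comment> \<open>The density is relative to Lebesgue measure on \<open>U\<close>, so
    \<open>A\<close> is first cut down to \<open>U\<close>; this loses nothing because
    \<open>X\<close> takes its values there.\<close>
  have "emeasure M {\<omega> \<in> space M. X \<omega> \<in> A} = emeasure M (X -` (A \<inter> U) \<inter> space M)"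
    using XU by (intro arg_cong[where f = "emeasure M"]) auto
  also have "\<dots> = (\<integral>\<^sup>+x. f x * indicator (A \<inter> U) x \<partial>?N)"
    by (rule distributed_emeasure[OF X AU])
  also have "\<dots> \<le> (\<integral>\<^sup>+x. ennreal K * indicator (A \<inter> U) x \<partial>?N)"
    using K by (intro nn_integral_mono) (auto simp: indicator_def)
  also have "\<dots> = ennreal K * emeasure lborel (A \<inter> U)"
    using AU U by (simp add: nn_integral_cmult_indicator emeasure_restrict_space)
  also have "\<dots> \<le> ennreal K * emeasure lborel A"
    using A by (intro mult_left_mono emeasure_mono) auto
  also have "\<dots> = ennreal (K * measure lborel A)"
    using A K(2) by (simp add: emeasure_eq_ennreal_measure ennreal_mult)
  finally show ?thesis
    using K(2) by (simp add: emeasure_eq_measure)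
qed

theorem theorem2:
  fixes \<alpha> R C \<delta> \<xi> r :: real
    and Y :: "(real ^ 'n) set"
    and M :: "'w measure"
    and X :: "'w \<Rightarrow> real ^ 'n"
    and \<rho> :: "real ^ 'n \<Rightarrow> real"
  assumes "0 < \<alpha>" "\<alpha> \<le> 1" "R > 0" "C > 0" "0 < \<delta>" "\<delta> < 1"
    and xi: "\<xi> = 1 / (2 * \<alpha>) + R * (1 + 1 / \<alpha>)" "\<xi> < 1"
    and r: "1 > r" "r > \<xi>"
    and Y: "finite Y" "Y \<subseteq> unit_ball"
      "real (card Y) < \<delta> * (1 / C) * (r / \<xi>) ^ CARD('n)"
    and M: "prob_space M"
    and density_X: "distributed M (restrict_space lborel unit_ball) X (\<lambda>x. ennreal (\<rho> x))"
    and rho_nonneg: "\<And>x. x \<in> unit_ball \<Longrightarrow> 0 \<le> \<rho> x"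
    and rho_less: "\<And>x. x \<in> unit_ball \<Longrightarrow>
      \<rho> x < C / (r ^ CARD('n) * measure lborel (unit_ball :: (real ^ 'n) set))"
  shows "measure M {\<omega> \<in> space M. \<forall>y\<in>Y.
      \<forall>x'\<in>spherical_granule R (X \<omega>). \<forall>y'\<in>spherical_granule R y.
        \<alpha> * (X \<omega> \<bullet> x') \<ge> X \<omega> \<bullet> y'} > 1 - \<delta>"
proof -
  interpret prob_space M by (rule M)
  let ?V = "measure lborel (unit_ball :: (real ^ 'n) set)"
  define K where "K = C / (r ^ CARD('n) * ?V)"
  define S where "S y = {x :: real ^ 'n. \<forall>x'\<in>spherical_granule R x. \<forall>y'\<in>spherical_granule R y.
    \<alpha> * (x \<bullet> x') \<ge> x \<bullet> y'}" for y
  \<comment> \<open>The bad event for \<open>y\<close>: its ball may stick out of the unit ball,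
    which only weakens the volume bound.\<close>
  define B where "B y = {\<omega> \<in> space M. X \<omega> \<in> ball ((1 / (2 * \<alpha>)) *\<^sub>R y) \<xi>}" for y
  have \<xi>: "\<xi> > 0" using assms(1,3) unfolding xi(1) by (simp add: add_pos_pos)
  have V: "?V = unit_ball_vol (real CARD('n))" "?V > 0"
    by (simp_all add: content_cball)
  have K: "K \<ge> 0" unfolding K_def using V \<xi> r assms(4) by simp
  have meas: "X \<in> measurable M (restrict_space lborel unit_ball)"
    by (rule distributed_measurable[OF density_X])
  have X_borel [measurable]: "X \<in> borel_measurable M"
    using meas by (simp add: measurable_restrict_space2_iff)
  have X_ball: "norm (X \<omega>) \<le> 1" if "\<omega> \<in> space M" for \<omega>
    using measurable_space[OF meas that] by (simp add: space_restrict_space)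
  have S_borel [measurable]: "S y \<in> sets borel" for y
    unfolding S_def by (intro borel_closed closed_granules_separated)
  have B_events [measurable]: "B y \<in> events" for y
    using measurable_sets[OF X_borel borel_open[OF open_ball]]
    by (simp add: B_def vimage_def Int_def conj_commute)
  let ?E = "{\<omega> \<in> space M. \<forall>y\<in>Y. X \<omega> \<in> S y}"
  have E: "?E \<in> events"
    using Y(1) by (intro sets.sets_Collect_finite_All) measurable
  have prob_B: "prob (B y) \<le> C * (\<xi> / r) ^ CARD('n)" for y
  proof -
    have "prob (B y) \<le> K * measure lborel (ball ((1 / (2 * \<alpha>)) *\<^sub>R y) \<xi>)"
      unfolding B_def
    proof (rule prob_le_of_bounded_density[OF density_X _ _ _ _ K])
      show "ennreal (\<rho> x) \<le> ennreal K" if "x \<in> unit_ball" for x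
        using rho_less[OF that] unfolding K_def by (intro ennreal_leI) simp
    qed (use emeasure_lborel_ball_finite in auto)
    also have "\<dots> = K * (?V * \<xi> ^ CARD('n))"
      using \<xi> by (simp add: content_ball V(1))
    \<comment> \<open>The volume of the unit ball cancels against the one in the denominator of
      \<open>K\<close>.\<close>
    also have "\<dots> = C * (\<xi> / r) ^ CARD('n)"
      unfolding K_def using V(2) \<xi> r by (simp add: field_simps)
    finally show ?thesis .
  qed
  have "space M - ?E \<subseteq> (\<Union>y\<in>Y. B y)"
  proof
    fix \<omega> assume \<omega>: "\<omega> \<in> space M - ?E"
    then obtain y u v where y: "y \<in> Y" and uv: "norm u \<le> R" "norm v \<le> R"
      and less: "\<alpha> * (X \<omega> \<bullet> (X \<omega> + u)) < X \<omega> \<bullet> (y + v)"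
      by (auto simp: S_def ball_spherical_granule_iff not_le)
    have "norm y \<le> 1" using y Y(2) by auto
    from violation_in_ball[OF assms(1-3) X_ball this uv less] \<omega>
    have "\<omega> \<in> B y" by (simp add: B_def xi(1))
    then show "\<omega> \<in> (\<Union>y\<in>Y. B y)" using y by blast
  qed
  then have "prob (space M - ?E) \<le> prob (\<Union>y\<in>Y. B y)"
    using Y(1) by (intro finite_measure_mono) auto
  also have "\<dots> \<le> (\<Sum>y\<in>Y. prob (B y))"
    using Y(1) by (intro finite_measure_subadditive_finite) auto
  also have "\<dots> \<le> real (card Y) * (C * (\<xi> / r) ^ CARD('n))"
    using prob_B by (rule sum_bounded_above)
  \<comment> \<open>The strict bound on \<open>card Y\<close> is multiplied by a positive number, so
    the estimate stays strict even for empty \<open>Y\<close>. The bound is the reciprocal of that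
    number times \<delta>.\<close>
  also have "\<dots> < \<delta> * (1 / C) * (r / \<xi>) ^ CARD('n) * (C * (\<xi> / r) ^ CARD('n))"
    using Y(3) \<xi> r assms(4) by (intro mult_strict_right_mono) auto
  also have "\<dots> = \<delta>"
    using \<xi> r assms(4) by (simp add: field_simps)
  finally have "prob ?E > 1 - \<delta>"
    using prob_compl[OF E] by simp
  then show ?thesis by (simp add: S_def)
qed

end
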